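(* Let $n\ge 2$, let $\delta=\sum_{i=1}^n\varepsilon_i\,dx_i\otimes dx_i$ with $\varepsilon_i=\pm1$ be a pseudo-Euclidean metric on $\mathbb{R}^n$, let $\alpha=(\alpha_1,\dots,\alpha_n)$ be a nonzero vector, and let $\xi(x_1,\dots,x_n)=\alpha_1x_1+\dots+\alpha_nx_n$. Let $\varphi,f:(a,b)\subset\mathbb{R}\to\mathbb{R}$ be smooth functions with $\varphi>0$, and write also $\varphi=\varphi\circ\xi$, $f=f\circ\xi$ for the compositions on $\xi^{-1}(a,b)$. Then the manifold $\xi^{-1}(a,b)\subset\mathbb{R}^n$ furnished with the metric $g=\delta/\varphi(x)^2$ is a gradient $k$-Yamabe soliton (with potential function $f$ and soliton constant $\lambda$) if and only if $$f''+2\frac{f'\varphi'}{\varphi}=0$$ and $$b_{n,k}\left[k\varphi\varphi''-\frac n2(\varphi')^2\right](\varphi')^{2(k-1)}\|\alpha\|^{2k}+\frac{\varphi\varphi'f'}{2(n-1)}\|\alpha\|^2=\lambda,$$ where $$b_{n,k}=\frac{(n-1)!}{k!(n-k)!}(-1)^{k-1}\frac1{2^{k-1}}.$$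
   Context: A pseudo-Riemannian manifold $(M^n,g)$ is a gradient $k$-Yamabe soliton ($1\le k\le n$) if there are a constant $\lambda\in\mathbb{R}$ (the soliton constant) and a function $f\in C^\infty(M)$ (the potential function) with $\nabla^2 f=2(n-1)(\sigma_k-\lambda)g$, where $\nabla^2 f$ is the Hessian of $f$ with respect to $g$ and $\sigma_k=\sum_{i_1<\dots<i_k}\lambda_{i_1}\cdots\lambda_{i_k}$ is the $k$-th elementary symmetric function of the eigenvalues $\lambda_1,\dots,\lambda_n$ of $g^{-1}A_g$. Here $A_g=\frac1{n-2}\left[Ric_g-\frac{scal_g}{2(n-1)}g\right]$ is the Schouten tensor; for a conformal metric $g=\delta/\varphi^2$ it is computed as $A_g=\frac{\nabla^2_\delta\varphi}{\varphi}-\frac{|\nabla_\delta\varphi|^2}{2\varphi^2}\delta$. Notation: $\|\alpha\|^2=\sum_i\varepsilon_i\alpha_i^2$ and $\|\alpha\|^{2k}=(\|\alpha\|^2)^k$; primes denote derivatives of the one-variable functions. *)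

theory Defs
  imports "HOL-Analysis.Analysis" "HOL-Computational_Algebra.Polynomial"
begin

text \<open>
  All manifolds here are open subsets \<open>U\<close> of \<open>real ^ 'n\<close>, and tensor fields are given by their
  components in the standard coordinates. Every derivative below is a two-sided one, so it is
  meaningful only at interior points of the domain of interest.
\<close>

section \<open>Smooth functions and partial derivatives\<close>

primrec Ck_on :: "nat \<Rightarrow> 'a::euclidean_space set \<Rightarrow> ('a \<Rightarrow> real) \<Rightarrow> bool" where
  "Ck_on 0 U F \<longleftrightarrow> continuous_on U F"
| "Ck_on (Suc m) U F \<longleftrightarrow>
     (\<forall>x\<in>U. F differentiable (at x)) \<and> (\<forall>v. Ck_on m U (\<lambda>x. frechet_derivative F (at x) v))"

definition smooth_on :: "'a::euclidean_space set \<Rightarrow> ('a \<Rightarrow> real) \<Rightarrow> bool" where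
  "smooth_on U F \<longleftrightarrow> (\<forall>m. Ck_on m U F)"

definition partial :: "'n::finite \<Rightarrow> (real ^ 'n \<Rightarrow> real) \<Rightarrow> real ^ 'n \<Rightarrow> real" where
  "partial i F x = frechet_derivative F (at x) (axis i 1)"


section \<open>Pseudo-Riemannian geometry in coordinates\<close>

definition pseudo_riemannian_metric_on ::
    "(real ^ 'n::finite) set \<Rightarrow> (real ^ 'n \<Rightarrow> real ^ 'n ^ 'n) \<Rightarrow> bool" where
  "pseudo_riemannian_metric_on U g \<longleftrightarrow>
     (\<forall>i j. smooth_on U (\<lambda>x. g x $ i $ j)) \<and>
     (\<forall>x\<in>U. transpose (g x) = g x \<and> invertible (g x))"

text \<open>\<open>christoffel g l i j\<close> is the symbol $\Gamma^l_{ij}$.\<close>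

definition christoffel ::
    "(real ^ 'n::finite \<Rightarrow> real ^ 'n ^ 'n) \<Rightarrow> 'n \<Rightarrow> 'n \<Rightarrow> 'n \<Rightarrow> real ^ 'n \<Rightarrow> real" where
  "christoffel g l i j x =
     (\<Sum>m\<in>UNIV. matrix_inv (g x) $ l $ m *
        (partial i (\<lambda>y. g y $ j $ m) x + partial j (\<lambda>y. g y $ i $ m) x
           - partial m (\<lambda>y. g y $ i $ j) x)) / 2"

definition hessian ::
    "(real ^ 'n::finite \<Rightarrow> real ^ 'n ^ 'n) \<Rightarrow> (real ^ 'n \<Rightarrow> real) \<Rightarrow> real ^ 'n \<Rightarrow> real ^ 'n ^ 'n" where
  "hessian g F x =
     (\<chi> i j. partial i (partial j F) x - (\<Sum>l\<in>UNIV. christoffel g l i j x * partial l F x))"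

text \<open>
  \<open>riemann g l k i j\<close> is the component $R^l{}_{kij}$, with the convention
  $R(\partial_i, \partial_j)\partial_k = \sum_l R^l{}_{kij}\, \partial_l$ and
  $R(X, Y) = [\nabla_X, \nabla_Y] - \nabla_{[X, Y]}$. With the contraction used in \<open>ricci\<close>,
  round spheres have positive Ricci curvature.
\<close>

definition riemann ::
    "(real ^ 'n::finite \<Rightarrow> real ^ 'n ^ 'n) \<Rightarrow> 'n \<Rightarrow> 'n \<Rightarrow> 'n \<Rightarrow> 'n \<Rightarrow> real ^ 'n \<Rightarrow> real" where
  "riemann g l k i j x =
     partial i (christoffel g l j k) x - partial j (christoffel g l i k) x
     + (\<Sum>m\<in>UNIV. christoffel g l i m x * christoffel g m j k x
                 - christoffel g l j m x * christoffel g m i k x)"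

definition ricci ::
    "(real ^ 'n::finite \<Rightarrow> real ^ 'n ^ 'n) \<Rightarrow> real ^ 'n \<Rightarrow> real ^ 'n ^ 'n" where
  "ricci g x = (\<chi> j k. \<Sum>i\<in>UNIV. riemann g i k i j x)"

definition scal :: "(real ^ 'n::finite \<Rightarrow> real ^ 'n ^ 'n) \<Rightarrow> real ^ 'n \<Rightarrow> real" where
  "scal g x = (\<Sum>i\<in>UNIV. \<Sum>j\<in>UNIV. matrix_inv (g x) $ i $ j * ricci g x $ i $ j)"


section \<open>The Schouten tensor\<close>

text \<open>The pseudo-Euclidean square norm $\sum_i \varepsilon_i v_i^2$.\<close>

definition pe_norm2 :: "('n::finite \<Rightarrow> real) \<Rightarrow> real ^ 'n \<Rightarrow> real" where
  "pe_norm2 eps v = (\<Sum>i\<in>UNIV. eps i * (v $ i)\<^sup>2)"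

text \<open>The metric $\delta / u^2$ with $\delta = \sum_i \varepsilon_i\, dx_i \otimes dx_i$.\<close>

definition conformal_metric ::
    "('n::finite \<Rightarrow> real) \<Rightarrow> (real ^ 'n \<Rightarrow> real) \<Rightarrow> real ^ 'n \<Rightarrow> real ^ 'n ^ 'n" where
  "conformal_metric eps u x = (\<chi> i j. if i = j then eps i / (u x)\<^sup>2 else 0)"

text \<open>
  The expression $\nabla^2_\delta u / u - |\nabla_\delta u|^2 \delta / (2 u^2)$. The
  $\delta$-gradient of \<open>u\<close> has components $\varepsilon_i \partial_i u$, so its $\delta$-square norm
  is the one of the vector of partial derivatives because $\varepsilon_i^2 = 1$.
\<close>

definition conformal_schouten ::
    "('n::finite \<Rightarrow> real) \<Rightarrow> (real ^ 'n \<Rightarrow> real) \<Rightarrow> real ^ 'n \<Rightarrow> real ^ 'n ^ 'n" where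
  "conformal_schouten eps u x =
     (\<chi> i j. partial i (partial j u) x / u x
        - pe_norm2 eps (\<chi> l. partial l u x) / (2 * (u x)\<^sup>2) * (if i = j then eps i else 0))"

text \<open>
  \<open>A\<close> is the Schouten tensor of \<open>g\<close> on \<open>U\<close>. In dimension at least 3 it is defined from the Ricci
  curvature. In dimension 2 that formula reads \<open>0 / 0\<close>, and the convention is to use the conformal
  expression for metrics of the form $\delta / u^2$ in the given coordinates; \<open>g\<close> determines
  $\varepsilon$ and the positive function \<open>u\<close>, hence \<open>A\<close>, on a nonempty open set \<open>U\<close>.
\<close>

definition schouten_on ::
    "(real ^ 'n::finite) set \<Rightarrow> (real ^ 'n \<Rightarrow> real ^ 'n ^ 'n) \<Rightarrow> (real ^ 'n \<Rightarrow> real ^ 'n ^ 'n) \<Rightarrow> bool"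
  where
  "schouten_on U g A \<longleftrightarrow>
     (3 \<le> CARD('n) \<and>
      (\<forall>x\<in>U. A x = (1 / (real CARD('n) - 2)) *\<^sub>R
                     (ricci g x - (scal g x / (2 * (real CARD('n) - 1))) *\<^sub>R g x)))
   \<or> (CARD('n) = 2 \<and>
      (\<exists>eps u. (\<forall>i. eps i = 1 \<or> eps i = - 1) \<and> smooth_on U u \<and> (\<forall>x\<in>U. u x > 0) \<and>
         (\<forall>x\<in>U. g x = conformal_metric eps u x \<and> A x = conformal_schouten eps u x)))"


section \<open>Symmetric functions of eigenvalues\<close>

definition charpoly :: "complex ^ 'n ^ 'n::finite \<Rightarrow> complex poly" where
  "charpoly M = det (\<chi> i j. (if i = j then [:0, 1:] else 0) - [:M $ i $ j:])"

text \<open>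
  For indefinite metrics, $g^{-1} A_g$ need not be diagonalizable and its eigenvalues need not be
  real. So the eigenvalues are the complex ones, listed with their algebraic multiplicities; the
  order of the list is arbitrary, and \<open>elem_sym\<close> does not depend on it.
\<close>

definition eigenvalue_list :: "complex ^ 'n ^ 'n::finite \<Rightarrow> complex list" where
  "eigenvalue_list M = (SOME es. mset es = proots (charpoly M))"

definition elem_sym :: "nat \<Rightarrow> complex list \<Rightarrow> complex" where
  "elem_sym k es = (\<Sum>I | I \<subseteq> {..<length es} \<and> card I = k. \<Prod>i\<in>I. es ! i)"

definition sigma :: "nat \<Rightarrow> real ^ 'n ^ 'n::finite \<Rightarrow> real ^ 'n ^ 'n \<Rightarrow> complex" where
  "sigma k G A = elem_sym k (eigenvalue_list (map_matrix complex_of_real (matrix_inv G ** A)))"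


section \<open>Gradient k-Yamabe solitons\<close>

definition gradient_k_yamabe_soliton ::
    "nat \<Rightarrow> (real ^ 'n::finite) set \<Rightarrow> (real ^ 'n \<Rightarrow> real ^ 'n ^ 'n) \<Rightarrow> (real ^ 'n \<Rightarrow> real) \<Rightarrow> real \<Rightarrow> bool"
  where
  "gradient_k_yamabe_soliton k U g F lam \<longleftrightarrow>
     1 \<le> k \<and> k \<le> CARD('n) \<and> open U \<and> pseudo_riemannian_metric_on U g \<and> smooth_on U F \<and>
     (\<exists>A. schouten_on U g A \<and>
       (\<forall>x\<in>U. \<forall>i j. complex_of_real (hessian g F x $ i $ j) =
          2 * (of_nat CARD('n) - 1) * (sigma k (g x) (A x) - complex_of_real lam)
            * complex_of_real (g x $ i $ j)))"

definition yamabe_coeff :: "nat \<Rightarrow> nat \<Rightarrow> real" where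
  "yamabe_coeff n k = fact (n - 1) / (fact k * fact (n - k)) * (-1) ^ (k - 1) * (1 / 2 ^ (k - 1))"

end

theory Submission
  imports Defs
begin

text \<open>
  Write \<open>N\<close> for the square norm of \<open>\<alpha>\<close> with respect to the pseudo-Euclidean metric and \<open>t = \<alpha> \<bullet> x\<close>.
  All tensors in question are built from the rank one tensor \<open>\<alpha>\<^sub>i \<alpha>\<^sub>j\<close> and from
  \<open>\<epsilon>\<^sub>i \<delta>\<^sub>i\<^sub>j\<close>, with coefficients that are functions of \<open>t\<close>, and the theorem results from comparing
  coefficients.

  The Christoffel symbols of \<open>\<delta> / \<phi>\<^sup>2\<close> are \<open>- \<phi>' / \<phi>\<close> times a constant array
  (\<open>christoffel_conformal_ridge\<close>), so the Hessian of \<open>f\<close> is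
  $(f'' + 2 f'\varphi'/\varphi)\, \alpha_i\alpha_j - (\varphi' f' N/\varphi)\, \varepsilon_i\delta_{ij}$
  (\<open>hessian_ridge\<close>), and the Ricci tensor reduces to three contractions of that array (\<open>ricci_ridge\<close>).
  From it one finds that the Schouten tensor is the conformal expression
  $(\varphi''/\varphi)\, \alpha_i\alpha_j - (N \varphi'^2/(2\varphi^2))\, \varepsilon_i\delta_{ij}$
  (\<open>schouten_on_ridge_iff\<close>). After raising an index this is a scalar matrix plus a rank one matrix,
  whose characteristic polynomial the matrix determinant lemma computes: the eigenvalues are
  $\mu = - N\varphi'^2/2$ with multiplicity $n - 1$ and $\mu + N\varphi\varphi''$. Hence
  $\sigma_k = \binom{n}{k}\mu^k + \binom{n-1}{k-1} N\varphi\varphi''\mu^{k-1}$, which is the first term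
  of the second equation of the theorem (\<open>sigma_conformal_ridge\<close>, \<open>yamabe_coeff_binomial\<close>).

  The soliton equation thus says that a multiple of \<open>\<alpha>\<^sub>i \<alpha>\<^sub>j\<close> equals a multiple of
  \<open>\<epsilon>\<^sub>i \<delta>\<^sub>i\<^sub>j\<close>. As \<open>\<alpha>\<close> is nonzero and the dimension at least 2, both coefficients vanish
  (\<open>rank_one_eq_diagonal_iff\<close>). Their vanishing at \<open>t\<close> is the pair of differential equations there, and
  every \<open>t\<close> of the interval is a value of \<open>x \<mapsto> \<alpha> \<bullet> x\<close>.
\<close>

section \<open>Closure properties of smooth functions\<close>

text \<open>
  Openness matters: the derivative at a point of \<open>U\<close> is two-sided, so equality on \<open>U\<close> has to give
  equality near the point.
\<close>
lemma Ck_on_cong: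
  assumes "open U" "\<And>x. x \<in> U \<Longrightarrow> F x = G x"
  shows "Ck_on m U F \<longleftrightarrow> Ck_on m U G"
  using assms(2)
proof (induction m arbitrary: F G)
  case 0
  then show ?case by (auto intro: continuous_on_cong)
next
  case (Suc m)
  have der: "(F has_derivative D) (at x) \<longleftrightarrow> (G has_derivative D) (at x)" if "x \<in> U" for x D
    using that Suc.prems has_derivative_transform_within_open[OF _ assms(1) that] by metis
  have "frechet_derivative F (at x) = frechet_derivative G (at x)" if "x \<in> U" for x
    using der[OF that] by (simp add: frechet_derivative_def)
  then have "Ck_on m U (\<lambda>x. frechet_derivative F (at x) v) \<longleftrightarrow>
             Ck_on m U (\<lambda>x. frechet_derivative G (at x) v)" for v
    by (intro Suc.IH) simp
  then show ?case using der by (auto simp: differentiable_def)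
qed

lemma Ck_on_const: "Ck_on m U (\<lambda>x. c)"
  by (induction m arbitrary: c) auto

lemma Ck_on_lower: "Ck_on (Suc m) U F \<Longrightarrow> Ck_on m U F"
proof (induction m arbitrary: F)
  case 0
  then show ?case
    by (auto intro!: continuous_at_imp_continuous_on differentiable_imp_continuous_within)
next
  case (Suc m)
  then show ?case by (metis Ck_on.simps(2))
qed

lemma Ck_on_add:
  assumes "open U" "Ck_on m U F" "Ck_on m U G"
  shows "Ck_on m U (\<lambda>x. F x + G x)"
  using assms(2,3)
proof (induction m arbitrary: F G)
  case 0
  then show ?case by (auto intro: continuous_intros)
next
  case (Suc m)
  have "frechet_derivative (\<lambda>x. F x + G x) (at x) v
      = frechet_derivative F (at x) v + frechet_derivative G (at x) v" if "x \<in> U" for x v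
    using Suc.prems that by (auto simp: frechet_derivative_works
        intro!: fun_cong[OF frechet_derivative_at[symmetric]] has_derivative_add)
  then have "Ck_on m U (\<lambda>x. frechet_derivative (\<lambda>x. F x + G x) (at x) v)" for v
    using Suc by (subst Ck_on_cong[OF assms(1)]) (auto)
  then show ?case using Suc.prems by auto
qed

lemma Ck_on_mult:
  assumes "open U" "Ck_on m U F" "Ck_on m U G"
  shows "Ck_on m U (\<lambda>x. F x * G x)"
  using assms(2,3)
proof (induction m arbitrary: F G)
  case 0
  then show ?case by (auto intro: continuous_intros)
next
  case (Suc m)
  have fd: "frechet_derivative (\<lambda>x. F x * G x) (at x) v
      = F x * frechet_derivative G (at x) v + frechet_derivative F (at x) v * G x"
    if "x \<in> U" for x v
    using Suc.prems that by (auto simp: frechet_derivative_works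
        intro!: fun_cong[OF frechet_derivative_at[symmetric]] has_derivative_mult)
  have "Ck_on m U (\<lambda>x. frechet_derivative (\<lambda>x. F x * G x) (at x) v)" for v
    using Suc.prems Ck_on_lower[OF Suc.prems(1)] Ck_on_lower[OF Suc.prems(2)]
    by (subst Ck_on_cong[OF assms(1) fd]) (auto intro!: Ck_on_add[OF assms(1)] Suc.IH)
  then show ?case using Suc.prems by auto
qed

text \<open>
  The derivative is \<open>- (DF / F) / F\<close>, a product of derivatives of \<open>F\<close> and of the function \<open>1 / F\<close> itself
  at one order of differentiability lower.
\<close>
lemma Ck_on_inverse:
  assumes "open U" "Ck_on m U F" "\<And>x. x \<in> U \<Longrightarrow> F x \<noteq> 0"
  shows "Ck_on m U (\<lambda>x. inverse (F x))"
  using assms(2)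
proof (induction m)
  case 0
  then show ?case using assms(3) by (auto intro: continuous_intros)
next
  case (Suc m)
  have der: "((\<lambda>x. inverse (F x)) has_derivative
      (\<lambda>v. - (inverse (F x) * frechet_derivative F (at x) v * inverse (F x)))) (at x)"
    if "x \<in> U" for x
    using Suc.prems that assms(3) by (auto simp: frechet_derivative_works
        intro!: has_derivative_inverse)
  have fd: "frechet_derivative (\<lambda>x. inverse (F x)) (at x) v
      = (-1) * (inverse (F x) * frechet_derivative F (at x) v * inverse (F x))"
    if "x \<in> U" for x v
    using fun_cong[OF frechet_derivative_at[OF der[OF that]], of v] by simp
  have "Ck_on m U (\<lambda>x. (-1) * (inverse (F x) * frechet_derivative F (at x) v * inverse (F x)))" for v
    using Suc.prems Suc.IH[OF Ck_on_lower[OF Suc.prems]]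
    by (intro Ck_on_mult[OF assms(1)] Ck_on_const; simp)
  then have "Ck_on m U (\<lambda>x. frechet_derivative (\<lambda>x. inverse (F x)) (at x) v)" for v
    using Ck_on_cong[OF assms(1) fd] by simp
  then show ?case using der by (auto simp: differentiable_def)
qed

text \<open>
  The derivative of \<open>h \<circ> L\<close> in a fixed direction \<open>v\<close> is the derivative of \<open>h\<close> in the direction
  \<open>L v\<close>, again composed with \<open>L\<close>. So the induction hypothesis applies directly to the directional
  derivatives of \<open>h\<close>.
\<close>
lemma Ck_on_linear_compose:
  assumes "open I" "bounded_linear L" "Ck_on m I h"
  shows "Ck_on m (L -` I) (\<lambda>x. h (L x))"
  using assms(3)
proof (induction m arbitrary: h)
  case 0
  then show ?case
    using linear_continuous_on[OF assms(2)]
    by (auto intro!: continuous_on_compose2[of I h _ L])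
next
  case (Suc m)
  have op: "open (L -` I)"
    using assms(1,2) by (intro open_vimage) (auto intro: linear_continuous_on)
  have der: "((\<lambda>x. h (L x)) has_derivative (\<lambda>v. frechet_derivative h (at (L x)) (L v))) (at x)"
    if "L x \<in> I" for x
    using Suc.prems that bounded_linear_imp_has_derivative[OF assms(2)]
      diff_chain_at[of L L x h] by (auto simp: frechet_derivative_works o_def)
  have fd: "frechet_derivative (\<lambda>x. h (L x)) (at x) v = frechet_derivative h (at (L x)) (L v)"
    if "x \<in> L -` I" for x v
    using fun_cong[OF frechet_derivative_at[OF der], of x v] that by simp
  have "Ck_on m (L -` I) (\<lambda>x. frechet_derivative (\<lambda>x. h (L x)) (at x) v)" for v
    using Suc by (subst Ck_on_cong[OF op fd]) auto
  then show ?case using der by (auto simp: differentiable_def)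
qed

lemma smooth_on_deriv:
  assumes "open I" "smooth_on I h"
  shows "t \<in> I \<Longrightarrow> (h has_real_derivative deriv h t) (at t)" and "smooth_on I (deriv h)"
proof -
  have Ck: "Ck_on (Suc m) I h" for m
    using assms(2) unfolding smooth_on_def by blast
  have d: "(h has_real_derivative deriv h t) (at t)" if "t \<in> I" for t
    using Ck[of 0] that by (simp add: DERIV_deriv_iff_real_differentiable)
  then show "t \<in> I \<Longrightarrow> (h has_real_derivative deriv h t) (at t)" .
  have fd: "frechet_derivative h (at t) 1 = deriv h t" if "t \<in> I" for t
    using fun_cong[OF frechet_derivative_at[OF d[OF that, unfolded has_field_derivative_def]], of 1]
    by simp
  have "Ck_on m I (\<lambda>t. frechet_derivative h (at t) 1)" for m
    using Ck[of m] by simp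
  then show "smooth_on I (deriv h)"
    unfolding smooth_on_def using Ck_on_cong[OF assms(1) fd] by simp
qed

section \<open>Partial derivatives of ridge functions\<close>

lemma partial_cong:
  assumes "open U" "x \<in> U" "\<And>y. y \<in> U \<Longrightarrow> F y = G y"
  shows "partial i F x = partial i G x"
proof -
  have "(F has_derivative D) (at x) \<longleftrightarrow> (G has_derivative D) (at x)" for D
    using assms has_derivative_transform_within_open[OF _ assms(1,2)] by metis
  then show ?thesis by (simp add: partial_def frechet_derivative_def)
qed

lemma partial_ridge:
  assumes "(h has_real_derivative d) (at (\<alpha> \<bullet> x))"
  shows "partial i (\<lambda>y. h (\<alpha> \<bullet> y)) x = \<alpha> $ i * d"
proof -
  have "((\<lambda>y. h (\<alpha> \<bullet> y)) has_derivative (\<lambda>v. d * (\<alpha> \<bullet> v))) (at x)"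
    using has_derivative_compose[OF has_derivative_inner_right[OF has_derivative_ident, of \<alpha>]
        assms[unfolded has_field_derivative_def]] .
  then show ?thesis
    unfolding partial_def by (simp add: inner_axis flip: frechet_derivative_at)
qed

lemma open_ridge_domain:
  fixes \<alpha> :: "real ^ 'n"
  assumes "open I"
  shows "open {x. \<alpha> \<bullet> x \<in> I}"
  using open_vimage[OF assms, of "\<lambda>x. \<alpha> \<bullet> x"] by (simp add: vimage_def continuous_on_inner)

lemma partial_smooth_ridge:
  assumes "open I" "smooth_on I h" "\<alpha> \<bullet> x \<in> I"
  shows "partial i (\<lambda>y. h (\<alpha> \<bullet> y)) x = \<alpha> $ i * deriv h (\<alpha> \<bullet> x)"
  using assms smooth_on_deriv(1) by (intro partial_ridge) blast

lemma partial_partial_smooth_ridge: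
  assumes "open I" "smooth_on I h" "\<alpha> \<bullet> x \<in> I"
  shows "partial i (partial j (\<lambda>y. h (\<alpha> \<bullet> y))) x = \<alpha> $ i * \<alpha> $ j * deriv (deriv h) (\<alpha> \<bullet> x)"
proof -
  have "partial i (partial j (\<lambda>y. h (\<alpha> \<bullet> y))) x = partial i (\<lambda>y. \<alpha> $ j * deriv h (\<alpha> \<bullet> y)) x"
    using assms by (intro partial_cong[OF open_ridge_domain[OF assms(1), of \<alpha>]] partial_smooth_ridge) auto
  also have "\<dots> = \<alpha> $ i * (\<alpha> $ j * deriv (deriv h) (\<alpha> \<bullet> x))"
    using assms by (intro partial_ridge[of "\<lambda>t. \<alpha> $ j * deriv h t"] DERIV_cmult
        smooth_on_deriv(1)[OF assms(1) smooth_on_deriv(2)[OF assms(1)]])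
  finally show ?thesis by simp
qed

section \<open>Elementary symmetric functions of a scalar plus rank one matrix\<close>

text \<open>
  In the Leibniz expansion a permutation that contributes must fix every index other than \<open>k\<close>, hence
  also \<open>k\<close>.
\<close>
lemma det_scalar_rows_one_replaced:
  fixes p :: "'a::comm_ring_1" and v :: "'a ^ 'n"
  shows "det (\<chi> i. if i = k then v else p *s axis i 1 :: 'a ^ 'n ^ 'n) = v $ k * p ^ (CARD('n) - 1)"
proof -
  let ?A = "\<chi> i. if i = k then v else p *s axis i 1 :: 'a ^ 'n ^ 'n"
  have "(\<Prod>i\<in>UNIV. ?A $ i $ q i) = 0" if q: "q permutes UNIV" "q \<noteq> id" for q
  proof -
    obtain i where i: "i \<noteq> k" "q i \<noteq> i"
    proof (rule ccontr)
      assume "\<not> thesis"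
      then have fixed: "q i = i" if "i \<noteq> k" for i
        using that \<open>\<And>i. \<lbrakk>i \<noteq> k; q i \<noteq> i\<rbrakk> \<Longrightarrow> thesis\<close> by blast
      then have "q k = k"
        using permutes_inj[OF q(1)] by (metis injD)
      with fixed have "q = id" by (metis eq_id_iff)
      with q(2) show False by simp
    qed
    then have "?A $ i $ q i = 0" by (simp add: axis_def)
    then show ?thesis by (metis (no_types, lifting) finite UNIV_I prod_zero)
  qed
  then have "det ?A = (\<Sum>q\<in>{id}. of_int (sign q) * (\<Prod>i\<in>UNIV. ?A $ i $ q i))"
    unfolding det_def by (intro sum.mono_neutral_right) (auto simp: permutes_id)
  also have "\<dots> = (\<Prod>i\<in>UNIV. if i = k then v $ k else p)"
    by (auto simp: axis_def sign_id intro!: prod.cong)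
  also have "\<dots> = v $ k * (\<Prod>i\<in>UNIV - {k}. p)"
    by (subst prod.remove[of _ k]) (auto intro!: prod.cong arg_cong2[of _ _ _ _ "(*)"])
  finally show ?thesis by (simp add: card_Diff_singleton)
qed

text \<open>
  With the row \<open>v\<close> present at position \<open>k\<close>, the summand \<open>u $ i *s v\<close> of another row only adds
  determinants with two equal rows.
\<close>
lemma det_rank_one_rows_one_replaced:
  fixes p :: "'a::comm_ring_1" and u v :: "'a ^ 'n"
  assumes "finite S" "k \<notin> S"
  shows "det (\<chi> i. if i = k then v else if i \<in> S then p *s axis i 1 + u $ i *s v else p *s axis i 1 :: 'a ^ 'n ^ 'n)
    = v $ k * p ^ (CARD('n) - 1)"
  using assms
proof (induction S)
  case empty
  then show ?case by (simp add: det_scalar_rows_one_replaced cong: if_cong)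
next
  case (insert l S)
  define c where "c = (\<lambda>i. if i = k then v else if i \<in> S then p *s axis i 1 + u $ i *s v else p *s axis i 1)"
  have split: "(\<chi> i. if i = k then v else if i \<in> insert l S then p *s axis i 1 + u $ i *s v else p *s axis i 1)
      = (\<chi> i. if i = l then p *s axis i 1 + u $ l *s v else c i)"
    using insert.hyps insert.prems by (auto simp: vec_eq_iff c_def)
  have add: "det (\<chi> i. if i = l then p *s axis i 1 + u $ l *s v else c i)
      = det (\<chi> i. if i = l then p *s axis i 1 else c i) + u $ l * det (\<chi> i. if i = l then v else c i)"
    unfolding det_row_mul[of l "u $ l" "\<lambda>i. v" c, symmetric]
    by (rule det_row_add[of l "\<lambda>i. p *s axis i 1" "\<lambda>i. u $ l *s v" c])
  have zero: "det (\<chi> i. if i = l then v else c i) = 0"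
    using insert.prems insert.hyps
    by (intro det_identical_rows[of k l]) (simp_all add: row_def c_def)
  have "(\<chi> i. if i = l then p *s axis i 1 else c i) = (\<chi> i. c i)"
    using insert.hyps insert.prems by (auto simp: vec_eq_iff c_def)
  moreover have "det (\<chi> i. c i) = v $ k * p ^ (CARD('n) - 1)"
    using insert.IH insert.prems by (simp add: c_def)
  ultimately show ?case unfolding split add zero by simp
qed

text \<open>
  The matrix determinant lemma for a multiple of the identity. It is needed over a polynomial ring,
  where \<open>p\<close> cannot be divided by, so the rank one term is switched on one row at a time (the rows in
  \<open>S\<close>), using linearity in the new row \<open>l\<close>.
\<close>
lemma det_scalar_plus_rank_one:
  fixes p :: "'a::comm_ring_1" and u v :: "'a ^ 'n"
  shows "det (\<chi> i j. (if i = j then p else 0) + u $ i * v $ j)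
    = p ^ (CARD('n) - 1) * (p + (\<Sum>i\<in>UNIV. u $ i * v $ i))"
proof -
  have "det (\<chi> i. if i \<in> S then p *s axis i 1 + u $ i *s v else p *s axis i 1 :: 'a ^ 'n ^ 'n)
    = p ^ (CARD('n) - 1) * (p + (\<Sum>i\<in>S. u $ i * v $ i))" if "finite S" for S
    using that
  proof (induction S)
    case empty
    have "det (\<chi> i. p *s axis i 1 :: 'a ^ 'n ^ 'n) = (\<Prod>i\<in>(UNIV :: 'n set). p)"
      by (subst det_diagonal) (auto simp: axis_def)
    also have "\<dots> = p ^ (CARD('n) - 1) * p"
      by (simp flip: power_Suc2)
    finally show ?case by simp
  next
    case (insert l S)
    define c where "c = (\<lambda>i. if i \<in> S then p *s axis i 1 + u $ i *s v else p *s axis i 1 :: 'a ^ 'n)"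
    have split: "(\<chi> i. if i \<in> insert l S then p *s axis i 1 + u $ i *s v else p *s axis i 1)
        = (\<chi> i. if i = l then p *s axis i 1 + u $ l *s v else c i)"
      using insert.hyps by (auto simp: vec_eq_iff c_def)
    have add: "det (\<chi> i. if i = l then p *s axis i 1 + u $ l *s v else c i)
        = det (\<chi> i. if i = l then p *s axis i 1 else c i) + u $ l * det (\<chi> i. if i = l then v else c i)"
      unfolding det_row_mul[of l "u $ l" "\<lambda>i. v" c, symmetric]
      by (rule det_row_add[of l "\<lambda>i. p *s axis i 1" "\<lambda>i. u $ l *s v" c])
    have repl: "det (\<chi> i. if i = l then v else c i) = v $ l * p ^ (CARD('n) - 1)"
      unfolding c_def by (rule det_rank_one_rows_one_replaced[OF insert.hyps])
    have same: "(\<chi> i. if i = l then p *s axis i 1 else c i) = (\<chi> i. c i)"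
      using insert.hyps by (auto simp: vec_eq_iff c_def)
    have IH: "det (\<chi> i. c i) = p ^ (CARD('n) - 1) * (p + (\<Sum>i\<in>S. u $ i * v $ i))"
      unfolding c_def by (rule insert.IH)
    show ?case unfolding split add repl same IH using insert.hyps by (simp add: algebra_simps)
  qed
  from this[of UNIV] have "det (\<chi> i. p *s axis i 1 + u $ i *s v :: 'a ^ 'n ^ 'n)
    = p ^ (CARD('n) - 1) * (p + (\<Sum>i\<in>UNIV. u $ i * v $ i))" by simp
  moreover have "(\<chi> i. p *s axis i 1 + u $ i *s v :: 'a ^ 'n ^ 'n)
      = (\<chi> i j. (if i = j then p else 0) + u $ i * v $ j)"
    by (auto simp: vec_eq_iff axis_def)
  ultimately show ?thesis by simp
qed

lemma charpoly_scalar_plus_rank_one: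
  fixes u v :: "'n::finite \<Rightarrow> complex"
  shows "charpoly (\<chi> i j. (if i = j then \<mu> else 0) + u i * v j :: complex ^ 'n ^ 'n)
    = [:- \<mu>, 1:] ^ (CARD('n) - 1) * [:- (\<mu> + (\<Sum>i\<in>UNIV. u i * v i)), 1:]"
proof -
  have c: "(\<Sum>i\<in>UNIV. [:- u i:] * [:v i:]) = [:- (\<Sum>i\<in>UNIV. u i * v i):]"
    by (rule poly_eqI) (simp add: coeff_sum coeff_pCons sum_negf mult.commute split: nat.split)
  have "charpoly (\<chi> i j. (if i = j then \<mu> else 0) + u i * v j :: complex ^ 'n ^ 'n)
    = det (\<chi> i j. (if i = j then [:- \<mu>, 1:] else 0) + (\<chi> i. [:- u i:]) $ i * (\<chi> i. [:v i:]) $ j)"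
    unfolding charpoly_def by (rule arg_cong[where f = det]) (auto simp: vec_eq_iff)
  also have "\<dots> = [:- \<mu>, 1:] ^ (CARD('n) - 1) * ([:- \<mu>, 1:] + (\<Sum>i\<in>UNIV. [:- u i:] * [:v i:]))"
    by (subst det_scalar_plus_rank_one) simp
  finally show ?thesis unfolding c by simp
qed

text \<open>
  Split the index sets by whether they contain the exceptional index \<open>j0\<close>.
\<close>
lemma sum_prod_subsets_one_exceptional:
  fixes x :: "'i \<Rightarrow> 'a::comm_semiring_1"
  assumes "finite J" "j0 \<notin> J" and x: "\<And>i. i \<in> J \<Longrightarrow> x i = \<mu>"
  shows "(\<Sum>I | I \<subseteq> insert j0 J \<and> card I = Suc r. \<Prod>i\<in>I. x i)
    = of_nat (card J choose Suc r) * \<mu> ^ Suc r + of_nat (card J choose r) * (x j0 * \<mu> ^ r)"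
proof -
  let ?P = "\<lambda>m. {I. I \<subseteq> J \<and> card I = m}"
  have fin: "finite I" if "I \<subseteq> J" for I using that assms(1) finite_subset by blast
  have split: "{I. I \<subseteq> insert j0 J \<and> card I = Suc r} = ?P (Suc r) \<union> insert j0 ` ?P r"
  proof (intro set_eqI iffI)
    fix I assume I: "I \<in> {I. I \<subseteq> insert j0 J \<and> card I = Suc r}"
    show "I \<in> ?P (Suc r) \<union> insert j0 ` ?P r"
    proof (cases "j0 \<in> I")
      case True
      have "I = insert j0 (I - {j0})" "I - {j0} \<subseteq> J" "card (I - {j0}) = r"
        using True I by auto
      then show ?thesis by blast
    qed (use I in auto)
  next
    fix I assume "I \<in> ?P (Suc r) \<union> insert j0 ` ?P r"
    then show "I \<in> {I. I \<subseteq> insert j0 J \<and> card I = Suc r}"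
      using assms(2) fin by (auto simp: card_insert_if subset_iff)
  qed
  have inj: "inj_on (insert j0) (?P r)"
    using assms(2) by (intro inj_onI) (metis (mono_tags, lifting) insert_ident mem_Collect_eq subset_iff)
  have pr: "(\<Prod>i\<in>I. x i) = \<mu> ^ card I" if "I \<subseteq> J" for I
    using that x by (simp add: subset_iff)
  have "(\<Sum>I | I \<subseteq> insert j0 J \<and> card I = Suc r. \<Prod>i\<in>I. x i)
      = (\<Sum>I\<in>?P (Suc r). \<Prod>i\<in>I. x i) + (\<Sum>I\<in>insert j0 ` ?P r. \<Prod>i\<in>I. x i)"
    unfolding split using assms by (intro sum.union_disjoint) auto
  also have "(\<Sum>I\<in>?P (Suc r). \<Prod>i\<in>I. x i) = (\<Sum>I\<in>?P (Suc r). \<mu> ^ Suc r)"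
    by (intro sum.cong) (auto simp: pr)
  also have "(\<Sum>I\<in>insert j0 ` ?P r. \<Prod>i\<in>I. x i) = (\<Sum>I\<in>?P r. x j0 * \<mu> ^ r)"
    unfolding sum.reindex[OF inj] o_def
  proof (intro sum.cong refl)
    fix I assume I: "I \<in> ?P r"
    then have "j0 \<notin> I" using assms(2) by blast
    with I show "(\<Prod>i\<in>insert j0 I. x i) = x j0 * \<mu> ^ r"
      using fin pr by simp
  qed
  finally show ?thesis by (simp add: n_subsets[OF assms(1)])
qed

lemma elem_sym_one_exceptional:
  assumes "mset es = replicate_mset m \<mu> + {#\<nu>#}" "1 \<le> k"
  shows "elem_sym k es = of_nat (m choose k) * \<mu> ^ k + of_nat (m choose (k - 1)) * (\<nu> * \<mu> ^ (k - 1))"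
proof -
  have len: "length es = Suc m" using arg_cong[OF assms(1), of size] by simp
  have "\<nu> \<in> set es" using arg_cong[OF assms(1), of set_mset] by auto
  then obtain xs ys where es: "es = xs @ \<nu> # ys" by (meson split_list)
  have "mset (xs @ ys) = replicate_mset m \<mu>" using assms(1) unfolding es by simp
  then have "set (xs @ ys) \<subseteq> {\<mu>}"
    by (metis set_mset_mset set_mset_replicate_mset_subset empty_subsetI order_refl)
  then have eq: "es ! i = \<mu>" if "i < length es" "i \<noteq> length xs" for i
    using that unfolding es
    by (cases "i < length xs") (auto simp: nth_append nth_Cons' subset_iff)
  have j0: "length xs < length es" unfolding es by simp
  have ins: "{..<length es} = insert (length xs) ({..<length es} - {length xs})"
    using j0 by auto
  obtain r where k: "k = Suc r" using assms(2) by (cases k) auto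
  have "elem_sym k es = of_nat (card ({..<length es} - {length xs}) choose Suc r) * \<mu> ^ Suc r
    + of_nat (card ({..<length es} - {length xs}) choose r) * (es ! length xs * \<mu> ^ r)"
    unfolding elem_sym_def k
    by (subst ins, rule sum_prod_subsets_one_exceptional) (auto simp: eq)
  moreover have "card ({..<length es} - {length xs}) = m"
    using j0 by (simp add: len)
  ultimately show ?thesis by (simp add: k es)
qed

text \<open>
  The eigenvalues are \<open>\<mu>\<close>, repeated one time less than the dimension, and \<open>\<mu> + (\<Sum>i\<in>UNIV. u i * v i)\<close>.
  Reading them off the characteristic polynomial makes the case of a non-diagonalizable matrix, where
  the sum vanishes, no exception.
\<close>
lemma elem_sym_eigenvalues_scalar_plus_rank_one:
  fixes u v :: "'n::finite \<Rightarrow> complex"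
  assumes "1 \<le> k"
  shows "elem_sym k (eigenvalue_list (\<chi> i j. (if i = j then \<mu> else 0) + u i * v j :: complex ^ 'n ^ 'n))
    = of_nat (CARD('n) choose k) * \<mu> ^ k
      + of_nat ((CARD('n) - 1) choose (k - 1)) * (\<Sum>i\<in>UNIV. u i * v i) * \<mu> ^ (k - 1)"
proof -
  let ?M = "\<chi> i j. (if i = j then \<mu> else 0) + u i * v j :: complex ^ 'n ^ 'n"
  let ?c = "\<Sum>i\<in>UNIV. u i * v i"
  have "mset (eigenvalue_list ?M) = proots (charpoly ?M)"
    unfolding eigenvalue_list_def by (rule someI_ex) (rule ex_mset)
  also have "\<dots> = repeat_mset (CARD('n) - 1) {#\<mu>#} + {#\<mu> + ?c#}"
    unfolding charpoly_scalar_plus_rank_one by (subst proots_mult) (auto simp: proots_power)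
  finally have "elem_sym k (eigenvalue_list ?M) =
      of_nat ((CARD('n) - 1) choose k) * \<mu> ^ k
    + of_nat ((CARD('n) - 1) choose (k - 1)) * ((\<mu> + ?c) * \<mu> ^ (k - 1))"
    using assms by (intro elem_sym_one_exceptional) (simp_all add: repeat_mset_replicate_mset)
  moreover obtain r where k: "k = Suc r" using assms by (cases k) auto
  moreover obtain m where "CARD('n) = Suc m" using zero_less_card_finite[where 'a = 'n]
    by (cases "CARD('n)") auto
  ultimately show ?thesis by (simp add: algebra_simps)
qed

section \<open>The connection of a conformal ridge metric\<close>

text \<open>
  A Kronecker symbol is kept as an opaque factor, so that a sum over an index that it binds collapses
  by rewriting with \<open>sum_kron\<close>, without case splits.
\<close>
definition kron :: "'n \<Rightarrow> 'n \<Rightarrow> real" where "kron i j = (if i = j then 1 else 0)"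

lemma kron_same [simp]: "kron i i = 1" by (simp add: kron_def)
lemma kron_commute: "kron i j = kron j i" by (simp add: kron_def)
lemma sum_kron: "(\<Sum>i\<in>UNIV. kron i j * F i) = F j" "(\<Sum>i\<in>UNIV. kron j i * F i) = F j"
  for F :: "'n::finite \<Rightarrow> real"
  by (simp_all add: kron_def if_distrib[where f = "\<lambda>x. x * _"] cong: if_cong)

lemma conformal_metric_kron: "conformal_metric eps u x $ i $ j = eps i * kron i j / (u x)\<^sup>2"
  by (simp add: conformal_metric_def kron_def)

lemma matrix_inv_conformal_metric:
  assumes "\<And>i. eps i = 1 \<or> eps i = - 1" "u x \<noteq> 0"
  shows "matrix_inv (conformal_metric eps u x) $ l $ m = kron l m * (eps l * (u x)\<^sup>2)"
    and "invertible (conformal_metric eps u x)"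
proof -
  let ?G = "conformal_metric eps u x" and ?H = "\<chi> i j. kron i j * (eps i * (u x)\<^sup>2)"
  have sq: "eps i * eps i = 1" for i using assms(1)[of i] by auto
  have "(?G ** ?H) $ i $ j = mat 1 $ i $ j" "(?H ** ?G) $ i $ j = mat 1 $ i $ j" for i j
  proof -
    have "(?G ** ?H) $ i $ j = (\<Sum>k\<in>UNIV. kron i k * (eps i / (u x)\<^sup>2 * (kron k j * (eps k * (u x)\<^sup>2))))"
      using assms(2) by (simp add: matrix_matrix_mult_def conformal_metric_kron mult_ac)
    then show "(?G ** ?H) $ i $ j = mat 1 $ i $ j"
      unfolding sum_kron using assms(2) by (simp add: mat_def kron_def sq)
    have "(?H ** ?G) $ i $ j = (\<Sum>k\<in>UNIV. kron i k * (eps i * (u x)\<^sup>2 * (eps k * kron k j / (u x)\<^sup>2)))"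
      using assms(2) by (simp add: matrix_matrix_mult_def conformal_metric_kron mult_ac)
    then show "(?H ** ?G) $ i $ j = mat 1 $ i $ j"
      unfolding sum_kron using assms(2) by (simp add: mat_def kron_def sq)
  qed
  then have 1: "?G ** ?H = mat 1" "?H ** ?G = mat 1" by (simp_all add: vec_eq_iff)
  then show "invertible ?G" unfolding invertible_def by blast
  have 2: "?G ** matrix_inv ?G = mat 1 \<and> matrix_inv ?G ** ?G = mat 1"
    unfolding matrix_inv_def using 1 by (intro someI[of "\<lambda>A'. ?G ** A' = mat 1 \<and> A' ** ?G = mat 1"]) auto
  have "matrix_inv ?G = ?H ** (?G ** matrix_inv ?G)"
    by (simp only: matrix_mul_assoc 1 matrix_mul_lid)
  also have "\<dots> = ?H" using 2 by (simp only: matrix_mul_rid)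
  finally show "matrix_inv ?G $ l $ m = kron l m * (eps l * (u x)\<^sup>2)" by simp
qed

text \<open>
  Since a ridge function \<open>\<phi>(\<alpha> \<bullet> x)\<close> has gradient \<open>\<phi>' \<alpha>\<close>, every Christoffel symbol of
  \<open>\<delta> / \<phi>\<^sup>2\<close> is the same scalar function \<open>- \<phi>' / \<phi>\<close> times an array of constants.
  The array $\delta_{lj}\alpha_i + \delta_{li}\alpha_j - \delta_{ij}\varepsilon_l\varepsilon_i\alpha_l$ is this one.
\<close>
definition ridge_connection :: "('n::finite \<Rightarrow> real) \<Rightarrow> real ^ 'n \<Rightarrow> 'n \<Rightarrow> 'n \<Rightarrow> 'n \<Rightarrow> real" where
  "ridge_connection eps \<alpha> l i j = kron l j * \<alpha> $ i + kron l i * \<alpha> $ j - kron i j * (eps l * eps i * \<alpha> $ l)"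

lemma christoffel_conformal_ridge:
  assumes eps: "\<And>i. eps i = 1 \<or> eps i = - 1"
    and p: "\<phi> (\<alpha> \<bullet> x) > 0"
    and der: "(\<phi> has_real_derivative d) (at (\<alpha> \<bullet> x))"
  shows "christoffel (conformal_metric eps (\<lambda>y. \<phi> (\<alpha> \<bullet> y))) l i j x
    = - (d / \<phi> (\<alpha> \<bullet> x)) * ridge_connection eps \<alpha> l i j"
proof -
  let ?p = "\<phi> (\<alpha> \<bullet> x)" and ?g = "conformal_metric eps (\<lambda>y. \<phi> (\<alpha> \<bullet> y))"
  have dm: "partial i (\<lambda>y. ?g y $ j $ m) x = - 2 * d / ?p ^ 3 * (eps j * kron j m * \<alpha> $ i)" for i j m
  proof -
    have "((\<lambda>t. eps j * kron j m / (\<phi> t)\<^sup>2) has_real_derivative - 2 * d / ?p ^ 3 * (eps j * kron j m)) (at (\<alpha> \<bullet> x))"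
      using p by (auto intro!: derivative_eq_intros der simp: field_simps power2_eq_square power3_eq_cube)
    from partial_ridge[OF this] show ?thesis by (simp add: conformal_metric_kron algebra_simps)
  qed
  have inv: "matrix_inv (?g x) $ l $ m = kron l m * (eps l * ?p\<^sup>2)" for m
    using p by (intro matrix_inv_conformal_metric(1)[OF eps]) simp
  have "christoffel ?g l i j x = eps l * ?p\<^sup>2 * (- 2 * d / ?p ^ 3) *
      (eps j * kron j l * \<alpha> $ i + eps i * kron i l * \<alpha> $ j - eps i * kron i j * \<alpha> $ l) / 2"
    unfolding christoffel_def dm inv mult.assoc sum_kron by (simp add: algebra_simps)
  also have "\<dots> = - (d / ?p) * (eps l * eps j * kron j l * \<alpha> $ i + eps l * eps i * kron i l * \<alpha> $ j
      - eps l * eps i * kron i j * \<alpha> $ l)"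
    using p by (simp add: field_simps power2_eq_square power3_eq_cube)
  also have "\<dots> = - (d / ?p) * (kron l j * \<alpha> $ i + kron l i * \<alpha> $ j - kron i j * (eps l * eps i * \<alpha> $ l))"
  proof -
    have "eps l * eps m * kron m l = kron l m" for m using eps[of l] by (auto simp: kron_def)
    then show ?thesis by (simp add: algebra_simps)
  qed
  finally show ?thesis unfolding ridge_connection_def .
qed

text \<open>
  The three contractions below are all that the Hessian and the Ricci tensor need of the connection
  array.
\<close>
lemma sum_ridge_connection_trace:
  fixes eps :: "'n::finite \<Rightarrow> real"
  assumes eps: "\<And>i. eps i = 1 \<or> eps i = - 1"
  shows "(\<Sum>i\<in>UNIV. ridge_connection eps \<alpha> i i j) = real CARD('n) * \<alpha> $ j"
proof -
  have "eps i * (eps i * x) = x" for i x using eps[of i] by auto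
  then show ?thesis
    by (simp add: ridge_connection_def sum.distrib sum_subtractf sum_kron mult.assoc)
qed

lemma sum_ridge_connection_vector:
  "(\<Sum>i\<in>UNIV. \<alpha> $ i * ridge_connection eps \<alpha> i j k)
    = 2 * \<alpha> $ j * \<alpha> $ k - kron j k * (eps j * pe_norm2 eps \<alpha>)"
proof -
  have "(\<Sum>i\<in>UNIV. \<alpha> $ i * ridge_connection eps \<alpha> i j k)
    = (\<Sum>i\<in>UNIV. kron i k * (\<alpha> $ i * \<alpha> $ j)) + (\<Sum>i\<in>UNIV. kron i j * (\<alpha> $ i * \<alpha> $ k))
      - kron j k * (eps j * (\<Sum>i\<in>UNIV. eps i * (\<alpha> $ i)\<^sup>2))"
    unfolding sum_distrib_left sum.distrib[symmetric] sum_subtractf[symmetric]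
    by (rule sum.cong) (simp_all add: ridge_connection_def algebra_simps power2_eq_square)
  then show ?thesis unfolding sum_kron by (simp add: pe_norm2_def)
qed

lemma sum_ridge_connection_square:
  fixes eps :: "'n::finite \<Rightarrow> real"
  assumes eps: "\<And>i. eps i = 1 \<or> eps i = - 1"
  shows "(\<Sum>i\<in>UNIV. \<Sum>m\<in>UNIV. ridge_connection eps \<alpha> i j m * ridge_connection eps \<alpha> m i k)
    = (real CARD('n) + 2) * \<alpha> $ j * \<alpha> $ k - 2 * kron j k * (eps j * pe_norm2 eps \<alpha>)"
proof -
  let ?C = "ridge_connection eps \<alpha>"
  have sq: "eps i * eps i = 1" for i using eps[of i] by auto
  have inner: "(\<Sum>m\<in>UNIV. ?C i j m * ?C m i k) = \<alpha> $ j * ?C i i k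
      + kron i j * (\<Sum>m\<in>UNIV. \<alpha> $ m * ?C m i k) - eps i * eps j * \<alpha> $ i * ?C j i k" for i
  proof -
    have "(\<Sum>m\<in>UNIV. ?C i j m * ?C m i k)
      = (\<Sum>m\<in>UNIV. kron i m * (\<alpha> $ j * ?C m i k)) + kron i j * (\<Sum>m\<in>UNIV. \<alpha> $ m * ?C m i k)
        - (\<Sum>m\<in>UNIV. kron j m * (eps i * eps j * \<alpha> $ i * ?C m i k))"
      unfolding sum_distrib_left sum.distrib[symmetric] sum_subtractf[symmetric]
      by (rule sum.cong) (simp_all add: ridge_connection_def[of _ _ i j] algebra_simps)
    then show ?thesis unfolding sum_kron .
  qed
  have last: "(\<Sum>i\<in>UNIV. eps i * eps j * \<alpha> $ i * ?C j i k) = kron j k * (eps j * pe_norm2 eps \<alpha>)"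
  proof -
    have "(\<Sum>i\<in>UNIV. eps i * eps j * \<alpha> $ i * ?C j i k)
      = kron j k * (eps j * (\<Sum>i\<in>UNIV. eps i * (\<alpha> $ i)\<^sup>2))
        + (\<Sum>i\<in>UNIV. kron i j * (eps i * eps j * \<alpha> $ i * \<alpha> $ k))
        - (\<Sum>i\<in>UNIV. kron i k * (eps i * eps i * (eps j * eps j) * \<alpha> $ i * \<alpha> $ j))"
      unfolding sum_distrib_left sum.distrib[symmetric] sum_subtractf[symmetric]
      by (rule sum.cong) (simp_all add: ridge_connection_def algebra_simps power2_eq_square kron_commute[of j])
    then show ?thesis unfolding sum_kron sq by (simp add: pe_norm2_def)
  qed
  have "(\<Sum>i\<in>UNIV. \<Sum>m\<in>UNIV. ?C i j m * ?C m i k)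
      = \<alpha> $ j * (\<Sum>i\<in>UNIV. ?C i i k) + (\<Sum>i\<in>UNIV. kron i j * (\<Sum>m\<in>UNIV. \<alpha> $ m * ?C m i k))
        - (\<Sum>i\<in>UNIV. eps i * eps j * \<alpha> $ i * ?C j i k)"
    unfolding inner by (simp add: sum.distrib sum_subtractf sum_distrib_left)
  then show ?thesis
    unfolding sum_kron last sum_ridge_connection_trace[OF eps] sum_ridge_connection_vector
    by (simp add: algebra_simps)
qed

section \<open>Hessian, Ricci and Schouten tensor of a conformal ridge metric\<close>

context
  fixes eps :: "'n::finite \<Rightarrow> real" and \<alpha> :: "real ^ 'n" and \<phi> :: "real \<Rightarrow> real" and I :: "real set"
  assumes eps: "\<And>i. eps i = 1 \<or> eps i = - 1"
    and I: "open I" and smooth: "smooth_on I \<phi>" and pos: "\<And>t. t \<in> I \<Longrightarrow> \<phi> t > 0"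
begin

private abbreviation (input) "\<Phi> \<equiv> \<lambda>x. \<phi> (\<alpha> \<bullet> x)"
private abbreviation (input) "g \<equiv> conformal_metric eps \<Phi>"
private abbreviation (input) "U \<equiv> {x. \<alpha> \<bullet> x \<in> I}"
private abbreviation (input) "N \<equiv> pe_norm2 eps \<alpha>"

lemma christoffel_ridge:
  assumes "x \<in> U"
  shows "christoffel g l i j x = - (deriv \<phi> (\<alpha> \<bullet> x) / \<phi> (\<alpha> \<bullet> x)) * ridge_connection eps \<alpha> l i j"
  using assms pos smooth_on_deriv(1)[OF I smooth] by (intro christoffel_conformal_ridge[OF eps]) auto

lemma hessian_ridge:
  assumes "smooth_on I f" "x \<in> U"
  defines "t \<equiv> \<alpha> \<bullet> x"
  shows "hessian g (\<lambda>y. f (\<alpha> \<bullet> y)) x $ i $ j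
    = \<alpha> $ i * \<alpha> $ j * (deriv (deriv f) t + 2 * (deriv f t * deriv \<phi> t / \<phi> t))
      - kron i j * (eps i * (deriv \<phi> t * deriv f t / \<phi> t * N))"
proof -
  have "(\<Sum>l\<in>UNIV. christoffel g l i j x * partial l (\<lambda>y. f (\<alpha> \<bullet> y)) x)
    = - (deriv \<phi> t / \<phi> t * deriv f t) * (\<Sum>l\<in>UNIV. \<alpha> $ l * ridge_connection eps \<alpha> l i j)"
    unfolding sum_distrib_left christoffel_ridge[OF assms(2)] partial_smooth_ridge[OF I assms(1), OF assms(2)[simplified]] t_def
    by (rule sum.cong) simp_all
  then show ?thesis
    unfolding hessian_def vec_lambda_beta sum_ridge_connection_vector
      partial_partial_smooth_ridge[OF I assms(1), OF assms(2)[simplified]] t_def[symmetric]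
    by (simp add: algebra_simps)
qed

lemma partial_christoffel_ridge:
  assumes "x \<in> U"
  defines "t \<equiv> \<alpha> \<bullet> x"
  shows "partial i (christoffel g l j k) x
    = ((deriv \<phi> t / \<phi> t)\<^sup>2 - deriv (deriv \<phi>) t / \<phi> t) * (\<alpha> $ i * ridge_connection eps \<alpha> l j k)"
proof -
  have t: "t \<in> I" "\<phi> t > 0" using assms pos by auto
  have "((\<lambda>t. - (deriv \<phi> t / \<phi> t) * ridge_connection eps \<alpha> l j k) has_real_derivative
      ((deriv \<phi> t / \<phi> t)\<^sup>2 - deriv (deriv \<phi>) t / \<phi> t) * ridge_connection eps \<alpha> l j k) (at t)"
    using t by (auto intro!: derivative_eq_intros smooth_on_deriv(1)[OF I smooth]
        smooth_on_deriv(1)[OF I smooth_on_deriv(2)[OF I smooth]]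
        simp: field_simps power2_eq_square)
  from partial_ridge[OF this[unfolded t_def]]
  have "partial i (\<lambda>y. - (deriv \<phi> (\<alpha> \<bullet> y) / \<phi> (\<alpha> \<bullet> y)) * ridge_connection eps \<alpha> l j k) x
    = ((deriv \<phi> t / \<phi> t)\<^sup>2 - deriv (deriv \<phi>) t / \<phi> t) * (\<alpha> $ i * ridge_connection eps \<alpha> l j k)"
    by (simp add: t_def)
  then show ?thesis
    using partial_cong[OF open_ridge_domain[OF I] assms(1) christoffel_ridge] by simp
qed

text \<open>
  With \<open>\<psi> = \<phi>' / \<phi>\<close> and the connection array \<open>C\<close>, the derivative terms of the Ricci tensor carry the
  factor \<open>- \<psi>'\<close> and the quadratic terms the factor \<open>\<psi>\<^sup>2\<close>, each times contractions of \<open>C\<close>; the stated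
  form results from \<open>\<psi>' = \<phi>'' / \<phi> - \<psi>\<^sup>2\<close>.
\<close>
lemma ricci_ridge:
  assumes "x \<in> U"
  defines "t \<equiv> \<alpha> \<bullet> x"
  shows "ricci g x $ j $ k
    = (real CARD('n) - 2) * (deriv (deriv \<phi>) t / \<phi> t) * \<alpha> $ j * \<alpha> $ k
      + kron j k * (eps j * N) * (deriv (deriv \<phi>) t / \<phi> t - (real CARD('n) - 1) * (deriv \<phi> t / \<phi> t)\<^sup>2)"
proof -
  let ?C = "ridge_connection eps \<alpha>"
  define p where "p = deriv \<phi> t / \<phi> t"
  define q where "q = deriv (deriv \<phi>) t / \<phi> t"
  have "riemann g i k i j x = (p\<^sup>2 - q) * (\<alpha> $ i * ?C i j k) - (p\<^sup>2 - q) * \<alpha> $ j * ?C i i k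
      + p\<^sup>2 * (\<Sum>m\<in>UNIV. ?C i i m * ?C m j k) - p\<^sup>2 * (\<Sum>m\<in>UNIV. ?C i j m * ?C m i k)" for i
    unfolding riemann_def partial_christoffel_ridge[OF assms(1)] christoffel_ridge[OF assms(1)]
      t_def[symmetric] p_def[symmetric] q_def[symmetric]
    by (simp add: sum_distrib_left sum_subtractf power2_eq_square algebra_simps)
  then have "ricci g x $ j $ k = (p\<^sup>2 - q) * (\<Sum>i\<in>UNIV. \<alpha> $ i * ?C i j k)
      - (p\<^sup>2 - q) * \<alpha> $ j * (\<Sum>i\<in>UNIV. ?C i i k)
      + p\<^sup>2 * (\<Sum>i\<in>UNIV. \<Sum>m\<in>UNIV. ?C i i m * ?C m j k)
      - p\<^sup>2 * (\<Sum>i\<in>UNIV. \<Sum>m\<in>UNIV. ?C i j m * ?C m i k)"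
    by (simp add: ricci_def sum.distrib sum_subtractf sum_distrib_left)
  moreover have "(\<Sum>i\<in>UNIV. \<Sum>m\<in>UNIV. ?C i i m * ?C m j k)
      = real CARD('n) * (\<Sum>m\<in>UNIV. \<alpha> $ m * ?C m j k)"
  proof -
    have "(\<Sum>i\<in>UNIV. \<Sum>m\<in>UNIV. ?C i i m * ?C m j k) = (\<Sum>m\<in>UNIV. (\<Sum>i\<in>UNIV. ?C i i m) * ?C m j k)"
      unfolding sum_distrib_right by (rule sum.swap)
    then show ?thesis
      unfolding sum_ridge_connection_trace[OF eps] by (simp add: sum_distrib_left mult.assoc)
  qed
  ultimately have "ricci g x $ j $ k =
      (real CARD('n) - 2) * q * \<alpha> $ j * \<alpha> $ k
      + kron j k * (eps j * N) * (q - (real CARD('n) - 1) * p\<^sup>2)"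
    unfolding sum_ridge_connection_trace[OF eps] sum_ridge_connection_vector
      sum_ridge_connection_square[OF eps] by (simp add: algebra_simps)
  then show ?thesis by (simp add: p_def q_def)
qed

lemma scal_ridge:
  assumes "x \<in> U"
  defines "t \<equiv> \<alpha> \<bullet> x"
  shows "scal g x = (real CARD('n) - 1) * N
    * (2 * \<phi> t * deriv (deriv \<phi>) t - real CARD('n) * (deriv \<phi> t)\<^sup>2)"
proof -
  have p: "\<phi> t > 0" using assms pos by auto
  have sq: "eps i * (eps i * y) = y" for i y using eps[of i] by auto
  have inv: "matrix_inv (g x) $ i $ j = kron i j * (eps i * (\<phi> t)\<^sup>2)" for i j
    using p unfolding t_def by (intro matrix_inv_conformal_metric(1)[OF eps]) simp
  define P where "P = (real CARD('n) - 2) * (deriv (deriv \<phi>) t / \<phi> t)"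
  define Q where "Q = N * (deriv (deriv \<phi>) t / \<phi> t - (real CARD('n) - 1) * (deriv \<phi> t / \<phi> t)\<^sup>2)"
  have "scal g x = (\<Sum>i\<in>UNIV. (eps i * (\<phi> t)\<^sup>2) * ricci g x $ i $ i)"
    unfolding scal_def inv mult.assoc sum_kron ..
  also have "\<dots> = (\<Sum>i\<in>UNIV. (\<phi> t)\<^sup>2 * P * (eps i * (\<alpha> $ i)\<^sup>2) + (\<phi> t)\<^sup>2 * Q)"
  proof (rule sum.cong)
    fix i
    have "ricci g x $ i $ i = P * (\<alpha> $ i)\<^sup>2 + eps i * Q"
      unfolding ricci_ridge[OF assms(1)] t_def[symmetric] P_def Q_def by (simp add: power2_eq_square mult.assoc)
    then show "(eps i * (\<phi> t)\<^sup>2) * ricci g x $ i $ i = (\<phi> t)\<^sup>2 * P * (eps i * (\<alpha> $ i)\<^sup>2) + (\<phi> t)\<^sup>2 * Q"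
      by (simp add: algebra_simps sq)
  qed simp
  also have "\<dots> = (\<phi> t)\<^sup>2 * P * N + real CARD('n) * ((\<phi> t)\<^sup>2 * Q)"
    by (simp add: sum.distrib sum_distrib_left[symmetric] pe_norm2_def)
  also have "\<dots> = (real CARD('n) - 1) * N
    * (2 * \<phi> t * deriv (deriv \<phi>) t - real CARD('n) * (deriv \<phi> t)\<^sup>2)"
    using p by (simp add: P_def Q_def field_simps power2_eq_square)
  finally show ?thesis .
qed

lemma conformal_schouten_ridge:
  assumes "x \<in> U"
  defines "t \<equiv> \<alpha> \<bullet> x"
  shows "conformal_schouten eps \<Phi> x $ i $ j
    = deriv (deriv \<phi>) t / \<phi> t * \<alpha> $ i * \<alpha> $ j - kron i j * (eps i * (N * (deriv \<phi> t / \<phi> t)\<^sup>2 / 2))"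
proof -
  have "pe_norm2 eps (\<chi> l. partial l \<Phi> x) = N * (deriv \<phi> t)\<^sup>2"
    unfolding partial_smooth_ridge[OF I smooth assms(1)[simplified]] pe_norm2_def t_def
    by (simp add: sum_distrib_right power_mult_distrib mult.assoc)
  then show ?thesis
    unfolding conformal_schouten_def vec_lambda_beta partial_partial_smooth_ridge[OF I smooth assms(1)[simplified]]
    by (simp add: kron_def t_def power_divide field_simps)
qed

lemma schouten_ridge:
  assumes "3 \<le> CARD('n)" "x \<in> U"
  shows "(1 / (real CARD('n) - 2)) *\<^sub>R (ricci g x - (scal g x / (2 * (real CARD('n) - 1))) *\<^sub>R g x)
    = conformal_schouten eps \<Phi> x"
proof -
  define t where "t = \<alpha> \<bullet> x"
  have p: "\<phi> t > 0" using assms pos by (auto simp: t_def)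
  \<comment> \<open>In terms of \<open>m\<close> all denominators are visibly positive.\<close>
  define m where "m = real CARD('n) - 2"
  have m: "real CARD('n) = m + 2" "m > 0" "m + 1 > 0" using assms(1) by (auto simp: m_def)
  have "(ricci g x $ i $ j - scal g x / (2 * (real CARD('n) - 1)) * g x $ i $ j) / (real CARD('n) - 2)
      = conformal_schouten eps \<Phi> x $ i $ j" for i j
    unfolding ricci_ridge[OF assms(2)] scal_ridge[OF assms(2)] conformal_schouten_ridge[OF assms(2)]
      conformal_metric_kron t_def[symmetric] m(1)
    using p m(2,3) by (simp add: divide_simps power2_eq_square) (simp add: algebra_simps)
  then show ?thesis by (simp add: vec_eq_iff)
qed

text \<open>
  In dimension 2 the Schouten tensor is given by some signature and some positive function that
  represent the metric. Comparing absolute values of diagonal entries shows that the function is \<open>\<Phi>\<close> on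
  \<open>U\<close>, hence has the same partial derivatives there, and then the signature is \<open>eps\<close>.
\<close>
lemma schouten_on_ridge_iff:
  assumes "2 \<le> CARD('n)" "smooth_on U \<Phi>"
  shows "schouten_on U g A \<longleftrightarrow> (\<forall>x\<in>U. A x = conformal_schouten eps \<Phi> x)"
proof (cases "CARD('n) = 2")
  case False
  then show ?thesis using assms(1) schouten_ridge by (simp add: schouten_on_def)
next
  case True
  show ?thesis
  proof
    assume "schouten_on U g A"
    then obtain e u where eu: "(\<forall>i. e i = 1 \<or> e i = - 1) \<and> smooth_on U u \<and> (\<forall>x\<in>U. u x > 0) \<and>
        (\<forall>x\<in>U. g x = conformal_metric e u x \<and> A x = conformal_schouten e u x)"
      using True unfolding schouten_on_def by auto
    then have e: "e i = 1 \<or> e i = - 1" for i by blast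
    have u: "u x > 0" and g: "g x = conformal_metric e u x"
      and A: "A x = conformal_schouten e u x" if "x \<in> U" for x
      using eu that by blast+
    have entry: "eps i / (\<Phi> x)\<^sup>2 = e i / (u x)\<^sup>2" if "x \<in> U" for x i
      using arg_cong[OF g[OF that], of "\<lambda>G. G $ i $ i"] by (simp add: conformal_metric_def)
    have u_eq: "u x = \<Phi> x" if x: "x \<in> U" for x
    proof -
      have "\<bar>eps i / (\<Phi> x)\<^sup>2\<bar> = \<bar>e i / (u x)\<^sup>2\<bar>" for i using entry[OF x] by simp
      moreover have "\<bar>eps i\<bar> = 1" "\<bar>e i\<bar> = 1" for i using eps[of i] e[of i] by auto
      ultimately have "(\<Phi> x)\<^sup>2 = (u x)\<^sup>2" by (simp add: abs_divide)
      then show ?thesis using u[OF x] pos x by (simp add: power2_eq_iff_nonneg less_imp_le)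
    qed
    have e_eq: "e = eps" if x: "x \<in> U" for x
    proof
      fix i
      have "\<Phi> x > 0" using pos x by simp
      then show "e i = eps i" using entry[OF x, of i] u_eq[OF x] by simp
    qed
    have "conformal_schouten e u x = conformal_schouten eps \<Phi> x" if x: "x \<in> U" for x
    proof -
      have 1: "partial i u y = partial i \<Phi> y" if "y \<in> U" for i y
        by (rule partial_cong[OF open_ridge_domain[OF I] that u_eq])
      have 2: "partial i (partial j u) x = partial i (partial j \<Phi>) x" for i j
        by (rule partial_cong[OF open_ridge_domain[OF I] x 1])
      show ?thesis
        unfolding conformal_schouten_def 2 1[OF x] u_eq[OF x] e_eq[OF x] ..
    qed
    then show "\<forall>x\<in>U. A x = conformal_schouten eps \<Phi> x" using A by simp
  next
    assume "\<forall>x\<in>U. A x = conformal_schouten eps \<Phi> x"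
    then have "(\<forall>i. eps i = 1 \<or> eps i = - 1) \<and> smooth_on U \<Phi> \<and> (\<forall>x\<in>U. \<Phi> x > 0) \<and>
        (\<forall>x\<in>U. g x = conformal_metric eps \<Phi> x \<and> A x = conformal_schouten eps \<Phi> x)"
      using eps assms(2) pos by auto
    then show "schouten_on U g A"
      using True unfolding schouten_on_def by blast
  qed
qed

end

section \<open>The soliton equation\<close>

text \<open>
  Raising an index turns the tensor into a scalar matrix plus the rank one matrix with entries
  $u^2 c\, \varepsilon_i \alpha_i \alpha_j$, whose trace is \<open>(u x)\<^sup>2 * c * pe_norm2 eps \<alpha>\<close>.
\<close>
lemma sigma_conformal_ridge:
  fixes eps :: "'n::finite \<Rightarrow> real" and \<alpha> :: "real ^ 'n"
  assumes eps: "\<And>i. eps i = 1 \<or> eps i = - 1" and "u x \<noteq> 0" "1 \<le> k"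
    and A: "\<And>i j. A $ i $ j = c * \<alpha> $ i * \<alpha> $ j + kron i j * (eps i * m)"
  shows "sigma k (conformal_metric eps u x) A = complex_of_real
    (of_nat (CARD('n) choose k) * ((u x)\<^sup>2 * m) ^ k
      + of_nat ((CARD('n) - 1) choose (k - 1)) * ((u x)\<^sup>2 * c * pe_norm2 eps \<alpha>) * ((u x)\<^sup>2 * m) ^ (k - 1))"
proof -
  let ?m = "complex_of_real ((u x)\<^sup>2 * m)"
  let ?v = "\<lambda>i. complex_of_real ((u x)\<^sup>2 * c * (eps i * \<alpha> $ i))" and ?w = "\<lambda>i. complex_of_real (\<alpha> $ i)"
  have inv: "matrix_inv (conformal_metric eps u x) $ i $ j = kron i j * (eps i * (u x)\<^sup>2)" for i j
    using assms(2) by (rule matrix_inv_conformal_metric(1)[OF eps])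
  have "(matrix_inv (conformal_metric eps u x) ** A) $ i $ j
      = kron i j * ((u x)\<^sup>2 * m) + (u x)\<^sup>2 * c * (eps i * \<alpha> $ i) * \<alpha> $ j" for i j
  proof -
    have "(matrix_inv (conformal_metric eps u x) ** A) $ i $ j = eps i * (u x)\<^sup>2 * A $ i $ j"
      unfolding matrix_matrix_mult_def vec_lambda_beta inv mult.assoc sum_kron ..
    then show ?thesis using eps[of i] by (auto simp: A algebra_simps)
  qed
  then have "map_matrix complex_of_real (matrix_inv (conformal_metric eps u x) ** A)
      = (\<chi> i j. (if i = j then ?m else 0) + ?v i * ?w j)"
    by (simp add: vec_eq_iff kron_def)
  moreover have "(\<Sum>i\<in>UNIV. ?v i * ?w i) = complex_of_real ((u x)\<^sup>2 * c * pe_norm2 eps \<alpha>)"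
    by (simp add: pe_norm2_def sum_distrib_left power2_eq_square mult.assoc)
  ultimately show ?thesis
    unfolding sigma_def by (simp add: elem_sym_eigenvalues_scalar_plus_rank_one[OF assms(3)])
qed

text \<open>
  Both binomial coefficients are multiples of \<open>(n - 1)! / (k! (n - k)!)\<close>: the first by \<open>n\<close>, the second
  by \<open>k\<close>. This is where the two terms \<open>k \<phi> \<phi>''\<close> and \<open>n / 2 \<phi>'\<^sup>2\<close> of the soliton equation come from.
\<close>
lemma yamabe_coeff_binomial:
  assumes "1 \<le> k" "k \<le> n"
  shows "of_nat (n choose k) * (- (N * d\<^sup>2 / 2)) ^ k
      + of_nat ((n - 1) choose (k - 1)) * (y * N) * (- (N * d\<^sup>2 / 2)) ^ (k - 1)
    = yamabe_coeff n k * (real k * y - real n / 2 * d\<^sup>2) * d ^ (2 * (k - 1)) * N ^ k"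
proof -
  obtain r where k: "k = Suc r" using assms(1) by (cases k) auto
  obtain m where n: "n = Suc m" using assms by (cases n) auto
  have r: "r \<le> m" using assms by (simp add: k n)
  define F where "F = fact m / (fact k * fact (m - r) :: real)"
  have ch1: "real (n choose k) = real n * F"
    using binomial_fact[OF assms(2), where 'a = real]
    by (simp add: k n F_def del: binomial_Suc_Suc of_nat_Suc fact_Suc) (simp add: fact_Suc)
  have ch2: "real (m choose r) = real k * F"
    using r by (simp add: binomial_fact k F_def field_simps del: of_nat_Suc)
  have pw: "(- (N * d\<^sup>2 / 2)) ^ r = (- 1) ^ r * (1 / 2 ^ r) * d ^ (2 * r) * N ^ r"
    by (simp add: power_mult power_mult_distrib power_divide power_minus[of "N * d\<^sup>2 / 2"])
  have "of_nat (n choose k) * (- (N * d\<^sup>2 / 2)) ^ k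
      + of_nat ((n - 1) choose (k - 1)) * (y * N) * (- (N * d\<^sup>2 / 2)) ^ (k - 1)
    = F * (real k * y - real n / 2 * d\<^sup>2) * N * (- (N * d\<^sup>2 / 2)) ^ r"
    using ch1 ch2 by (simp add: k n algebra_simps del: of_nat_Suc)
  also have "\<dots> = yamabe_coeff n k * (real k * y - real n / 2 * d\<^sup>2) * d ^ (2 * (k - 1)) * N ^ k"
    unfolding pw yamabe_coeff_def by (simp add: k n F_def del: of_nat_Suc fact_Suc)
  finally show ?thesis .
qed

text \<open>
  Take \<open>a\<close> with \<open>\<alpha> $ a \<noteq> 0\<close> and any other index \<open>b\<close>, which exists because the dimension is at
  least 2. The entry \<open>(a, b)\<close> gives \<open>\<alpha> $ b * E = 0\<close>, which turns the entry \<open>(b, b)\<close> into \<open>S = 0\<close>, and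
  then the entry \<open>(a, a)\<close> gives \<open>E = 0\<close>. This also covers a vector \<open>\<alpha>\<close> along a coordinate axis, for
  which all off-diagonal entries vanish identically.
\<close>
lemma rank_one_eq_diagonal_iff:
  fixes \<alpha> :: "real ^ 'n::finite"
  assumes "2 \<le> CARD('n)" "\<alpha> \<noteq> 0" and eps: "\<And>i. eps i \<noteq> (0::real)"
  shows "(\<forall>i j. \<alpha> $ i * \<alpha> $ j * E = kron i j * (eps i * S)) \<longleftrightarrow> E = 0 \<and> S = 0"
proof
  assume *: "\<forall>i j. \<alpha> $ i * \<alpha> $ j * E = kron i j * (eps i * S)"
  obtain a where a: "\<alpha> $ a \<noteq> 0" using assms(2) by (auto simp: vec_eq_iff)
  obtain b where b: "b \<noteq> a"
  proof (rule ccontr)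
    assume "\<not> thesis"
    then have "(UNIV :: 'n set) = {a}" using that by auto
    then have "CARD('n) = card {a}" by (rule arg_cong)
    then show False using assms(1) by simp
  qed
  have ab: "\<alpha> $ a * \<alpha> $ b * E = 0" using *[rule_format, of a b] b by (simp add: kron_def)
  have "\<alpha> $ b * \<alpha> $ b * E = eps b * S" using *[rule_format, of b b] by simp
  with ab a eps[of b] have S: "S = 0" by auto
  then have "\<alpha> $ a * \<alpha> $ a * E = 0" using *[rule_format, of a a] by simp
  with a S show "E = 0 \<and> S = 0" by simp
qed simp

lemma pseudo_riemannian_conformal_metric:
  fixes eps :: "'n::finite \<Rightarrow> real"
  assumes "\<And>i. eps i = 1 \<or> eps i = - 1" "open U" "smooth_on U u" "\<And>x. x \<in> U \<Longrightarrow> u x \<noteq> 0"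
  shows "pseudo_riemannian_metric_on U (conformal_metric eps u)"
  unfolding pseudo_riemannian_metric_on_def
proof (intro conjI allI ballI)
  fix i j
  have "Ck_on m U (\<lambda>x. eps i * kron i j * (inverse (u x) * inverse (u x)))" for m
    using assms by (intro Ck_on_mult Ck_on_inverse Ck_on_const) (auto simp: smooth_on_def)
  then show "smooth_on U (\<lambda>x. conformal_metric eps u x $ i $ j)"
    by (simp add: smooth_on_def conformal_metric_kron power2_eq_square divide_inverse)
next
  fix x
  show "transpose (conformal_metric eps u x) = conformal_metric eps u x"
    by (auto simp: transpose_def vec_eq_iff conformal_metric_kron kron_def)
  assume "x \<in> U"
  with assms(4) have "u x \<noteq> 0" .
  then show "invertible (conformal_metric eps u x)"
    by (rule matrix_inv_conformal_metric(2)[OF assms(1)])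
qed

theorem theorem1p1:
  fixes eps :: "'n::finite \<Rightarrow> real"
    and \<alpha> :: "real ^ 'n"
    and \<xi> :: "real ^ 'n \<Rightarrow> real"
    and a b :: ereal
    and \<phi> f :: "real \<Rightarrow> real"
    and lam :: real
    and k :: nat
  assumes dim: "CARD('n) \<ge> 2"
    and k: "1 \<le> k" "k \<le> CARD('n)"
    and eps: "\<And>i. eps i = 1 \<or> eps i = - 1"
    and alpha: "\<alpha> \<noteq> 0"
    and xi: "\<And>x. \<xi> x = (\<Sum>i\<in>UNIV. \<alpha> $ i * x $ i)"
    and ab: "a < b"
    and phi_smooth: "smooth_on (einterval a b) \<phi>"
    and f_smooth: "smooth_on (einterval a b) f"
    and phi_pos: "\<And>t. t \<in> einterval a b \<Longrightarrow> \<phi> t > 0"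
  shows "gradient_k_yamabe_soliton k (\<xi> -` einterval a b)
           (conformal_metric eps (\<phi> \<circ> \<xi>)) (f \<circ> \<xi>) lam
     \<longleftrightarrow>
       (\<forall>t\<in>einterval a b.
          deriv (deriv f) t + 2 * (deriv f t * deriv \<phi> t / \<phi> t) = 0) \<and>
       (\<forall>t\<in>einterval a b.
          yamabe_coeff CARD('n) k
            * (real k * \<phi> t * deriv (deriv \<phi>) t - real CARD('n) / 2 * (deriv \<phi> t)\<^sup>2)
            * deriv \<phi> t ^ (2 * (k - 1)) * pe_norm2 eps \<alpha> ^ k
          + \<phi> t * deriv \<phi> t * deriv f t / (2 * (real CARD('n) - 1)) * pe_norm2 eps \<alpha>
          = lam)"
proof -
  define I where "I = einterval a b"
  define U where "U = {x. \<alpha> \<bullet> x \<in> I}"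
  define g where "g = conformal_metric eps (\<lambda>x. \<phi> (\<alpha> \<bullet> x))"
  define F where "F = (\<lambda>x. f (\<alpha> \<bullet> x))"
  define N where "N = pe_norm2 eps \<alpha>"
  define A where "A = conformal_schouten eps (\<lambda>x. \<phi> (\<alpha> \<bullet> x))"
  define E where "E t = deriv (deriv f) t + 2 * (deriv f t * deriv \<phi> t / \<phi> t)" for t
  define s where "s t = yamabe_coeff CARD('n) k
      * (real k * (\<phi> t * deriv (deriv \<phi>) t) - real CARD('n) / 2 * (deriv \<phi> t)\<^sup>2)
      * deriv \<phi> t ^ (2 * (k - 1)) * N ^ k" for t
  have xi_eq: "\<xi> = (\<lambda>x. \<alpha> \<bullet> x)" by (simp add: fun_eq_iff xi inner_vec_def)
  have I: "open I" by (simp add: I_def)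
  have pos: "\<And>t. t \<in> I \<Longrightarrow> \<phi> t > 0" and phi: "smooth_on I \<phi>" and f: "smooth_on I f"
    using phi_pos phi_smooth f_smooth by (simp_all add: I_def)
  note ridge = eps I phi pos
  have U: "open U" using open_ridge_domain[OF I] by (simp add: U_def)
  have smooth_comp: "smooth_on U (\<lambda>x. h (\<alpha> \<bullet> x))" if "smooth_on I h" for h
    using Ck_on_linear_compose[OF I bounded_linear_inner_right, of _ h \<alpha>] that
    by (simp add: smooth_on_def U_def vimage_def)
  have metric: "pseudo_riemannian_metric_on U g"
    unfolding g_def using eps pos
    by (intro pseudo_riemannian_conformal_metric U smooth_comp phi) (force simp: U_def)+
  have schouten: "schouten_on U g B \<longleftrightarrow> (\<forall>x\<in>U. B x = A x)" for B
    unfolding g_def A_def U_def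
    using schouten_on_ridge_iff[OF ridge dim] smooth_comp[OF phi] by (simp add: U_def)
  \<comment> \<open>The scalar part of the Schouten tensor with one index raised is \<open>- N \<phi>'\<^sup>2 / 2\<close>
    and its rank one part has trace \<open>N \<phi> \<phi>''\<close>.\<close>
  have sigma: "sigma k (g x) (A x) = complex_of_real (s (\<alpha> \<bullet> x))" if x: "x \<in> U" for x
  proof -
    define t where "t = \<alpha> \<bullet> x"
    have p: "\<phi> t > 0" using pos x by (simp add: t_def U_def)
    have "A x $ i $ j = deriv (deriv \<phi>) t / \<phi> t * \<alpha> $ i * \<alpha> $ j
        + kron i j * (eps i * (- (N * (deriv \<phi> t / \<phi> t)\<^sup>2 / 2)))" for i j
      using x unfolding A_def by (subst conformal_schouten_ridge[OF ridge]) (auto simp: U_def N_def t_def)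
    from sigma_conformal_ridge[OF eps _ k(1) this] p
    have "sigma k (g x) (A x) = complex_of_real
      (of_nat (CARD('n) choose k) * ((\<phi> t)\<^sup>2 * (- (N * (deriv \<phi> t / \<phi> t)\<^sup>2 / 2))) ^ k
      + of_nat ((CARD('n) - 1) choose (k - 1)) * ((\<phi> t)\<^sup>2 * (deriv (deriv \<phi>) t / \<phi> t) * N)
        * ((\<phi> t)\<^sup>2 * (- (N * (deriv \<phi> t / \<phi> t)\<^sup>2 / 2))) ^ (k - 1))"
      unfolding g_def N_def t_def by (metis less_irrefl)
    also have "(\<phi> t)\<^sup>2 * (- (N * (deriv \<phi> t / \<phi> t)\<^sup>2 / 2)) = - (N * (deriv \<phi> t)\<^sup>2 / 2)"
      using p by (simp add: power_divide)
    also have "(\<phi> t)\<^sup>2 * (deriv (deriv \<phi>) t / \<phi> t) = \<phi> t * deriv (deriv \<phi>) t"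
      using p by (simp add: power2_eq_square)
    finally show ?thesis unfolding yamabe_coeff_binomial[OF k] s_def t_def .
  qed
  have point: "(\<forall>i j. complex_of_real (hessian g F x $ i $ j) =
        2 * (of_nat CARD('n) - 1) * (sigma k (g x) (A x) - complex_of_real lam) * complex_of_real (g x $ i $ j))
      \<longleftrightarrow> E t = 0 \<and> s t + \<phi> t * deriv \<phi> t * deriv f t / (2 * (real CARD('n) - 1)) * N = lam"
    if x: "x \<in> U" and t: "t = \<alpha> \<bullet> x" for x t
  proof -
    have p: "\<phi> t > 0" using pos x t by (simp add: U_def)
    have n: "real CARD('n) - 1 > 0" using dim by linarith
    \<comment> \<open>The soliton equation has only two kinds of terms, multiples of \<open>\<alpha>\<^sub>i \<alpha>\<^sub>j\<close> and of \<open>\<delta>\<^sub>i\<^sub>j \<epsilon>\<^sub>i\<close>;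
      \<open>E t\<close> and \<open>S\<close> are their coefficients.\<close>
    define S where "S = 2 * (real CARD('n) - 1) * (s t - lam) / (\<phi> t)\<^sup>2 + deriv \<phi> t * deriv f t / \<phi> t * N"
    have "complex_of_real (hessian g F x $ i $ j) =
        2 * (of_nat CARD('n) - 1) * (sigma k (g x) (A x) - complex_of_real lam) * complex_of_real (g x $ i $ j)
      \<longleftrightarrow> \<alpha> $ i * \<alpha> $ j * E t = kron i j * (eps i * S)" for i j
    proof -
      have H: "hessian g F x $ i $ j = \<alpha> $ i * \<alpha> $ j * E t - kron i j * (eps i * (deriv \<phi> t * deriv f t / \<phi> t * N))"
        using x unfolding g_def F_def by (subst hessian_ridge[OF ridge f]) (auto simp: U_def E_def N_def t)
      have G: "g x $ i $ j = kron i j * (eps i / (\<phi> t)\<^sup>2)" by (simp add: g_def conformal_metric_kron t)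
      have rhs: "2 * (of_nat CARD('n) - 1) * (sigma k (g x) (A x) - complex_of_real lam) * complex_of_real (g x $ i $ j)
        = complex_of_real (2 * (real CARD('n) - 1) * (s t - lam) * g x $ i $ j)"
        unfolding sigma[OF x] t by simp
      have "kron i j * (eps i * S) = 2 * (real CARD('n) - 1) * (s t - lam) * g x $ i $ j
          + kron i j * (eps i * (deriv \<phi> t * deriv f t / \<phi> t * N))"
        unfolding G S_def by (simp add: distrib_left)
      then show ?thesis unfolding rhs of_real_eq_iff H by (simp only: diff_eq_eq)
    qed
    then have "(\<forall>i j. complex_of_real (hessian g F x $ i $ j) =
        2 * (of_nat CARD('n) - 1) * (sigma k (g x) (A x) - complex_of_real lam) * complex_of_real (g x $ i $ j))
      \<longleftrightarrow> (\<forall>i j. \<alpha> $ i * \<alpha> $ j * E t = kron i j * (eps i * S))" by simp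
    also have "\<dots> \<longleftrightarrow> E t = 0 \<and> S = 0"
    proof (rule rank_one_eq_diagonal_iff[OF dim alpha])
      show "eps i \<noteq> 0" for i using eps[of i] by auto
    qed
    also have "S = 0 \<longleftrightarrow> s t + \<phi> t * deriv \<phi> t * deriv f t / (2 * (real CARD('n) - 1)) * N = lam"
    proof -
      have "S * (\<phi> t)\<^sup>2 / (2 * (real CARD('n) - 1))
          = s t + \<phi> t * deriv \<phi> t * deriv f t / (2 * (real CARD('n) - 1)) * N - lam"
        using p n by (simp add: S_def field_simps power2_eq_square)
      moreover have "S = 0 \<longleftrightarrow> S * (\<phi> t)\<^sup>2 / (2 * (real CARD('n) - 1)) = 0" using p n by simp
      ultimately show ?thesis by simp
    qed
    finally show ?thesis .
  qed
  \<comment> \<open>A preimage of \<open>t\<close> on the line through \<open>\<alpha>\<close>; here \<open>\<bullet>\<close> is the Euclidean product, so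
    \<open>\<alpha> \<bullet> \<alpha> \<noteq> 0\<close> also for a null vector \<open>\<alpha>\<close>.\<close>
  have onto: "\<exists>x\<in>U. t = \<alpha> \<bullet> x" if "t \<in> I" for t
    using that alpha by (intro bexI[of _ "(t / (\<alpha> \<bullet> \<alpha>)) *\<^sub>R \<alpha>"]) (simp_all add: U_def)
  have "gradient_k_yamabe_soliton k U g F lam \<longleftrightarrow> (\<forall>x\<in>U. \<forall>i j. complex_of_real (hessian g F x $ i $ j) =
        2 * (of_nat CARD('n) - 1) * (sigma k (g x) (A x) - complex_of_real lam) * complex_of_real (g x $ i $ j))"
    unfolding gradient_k_yamabe_soliton_def schouten
    using k U metric smooth_comp[OF f] by (auto simp: F_def)
  also have "\<dots> \<longleftrightarrow> (\<forall>t\<in>I. E t = 0 \<and> s t + \<phi> t * deriv \<phi> t * deriv f t / (2 * (real CARD('n) - 1)) * N = lam)"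
  proof -
    have img: "I = (\<lambda>x. \<alpha> \<bullet> x) ` U" using onto by (auto simp: U_def)
    show ?thesis by (subst img) (unfold ball_simps, rule ball_cong[OF refl point[OF _ refl]])
  qed
  finally show ?thesis
    unfolding U_def g_def F_def E_def s_def N_def I_def xi_eq
    by (simp add: vimage_def o_def ball_conj_distrib mult.assoc)
qed

end
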